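(* Let $A$ be a closed densely defined operator in a complex Hilbert space $\mathcal H$ and let $E$ be the spectral measure of $|A|$. Then the following three conditions are equivalent: (i) $A$ is quasinormal; (ii) $\langle E(\sigma)Af, Af\rangle = \langle E(\sigma)|A|f, |A|f\rangle$ for all $\sigma\in\mathfrak B(\mathbb R_+)$ and $f\in\mathcal D(A)$; (iii) $\langle E(\cdot)Af, Af\rangle \ll \langle E(\cdot)|A|f,|A|f\rangle$ for every $f\in\mathcal D(A)$.
   Context: All operators are linear and possibly unbounded; $\mathcal D(A)$ denotes the domain of $A$. $\mathbb R_+=[0,\infty)$ and $\mathfrak B(\mathbb R_+)$ is the $\sigma$-algebra of Borel subsets of $\mathbb R_+$. For a closed densely defined $A$, $|A|$ is the (positive selfadjoint) square root of $A^*A$, so that $\mathcal D(|A|)=\mathcal D(A)$; its spectral measure is regarded as a spectral measure on $\mathfrak B(\mathbb R_+)$. For operators $S,T$ in $\mathcal H$, $S\subseteq T$ means $\mathcal D(S)\subseteq\mathcal D(T)$ and $Sf=Tf$ for all $f\in\mathcal D(S)$. A closed densely defined operator $A$ in $\mathcal H$ is called quasinormal if $E(\sigma)A\subseteq AE(\sigma)$ for all $\sigma\in\mathfrak B(\mathbb R_+)$, where $E$ is the spectral measure of $|A|$. For finite positive Borel measures $\mu,\nu$ on $\mathbb R_+$, $\mu\ll\nu$ means that $\mu$ is absolutely continuous with respect to $\nu$; $\langle E(\cdot)h,h\rangle$ denotes the finite positive Borel measure $\sigma\mapsto\langle E(\sigma)h,h\rangle$. *)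

theory Defs
  imports "HOL-Analysis.Analysis"
begin

text \<open>Complex Hilbert spaces; the inner product is linear in the first argument.\<close>

class complex_inner = real_normed_vector +
  fixes scaleC :: "complex \<Rightarrow> 'a \<Rightarrow> 'a"
    and cinner :: "'a \<Rightarrow> 'a \<Rightarrow> complex"
  assumes scaleC_add_right: "scaleC a (x + y) = scaleC a x + scaleC a y"
    and scaleC_add_left: "scaleC (a + b) x = scaleC a x + scaleC b x"
    and scaleC_scaleC: "scaleC a (scaleC b x) = scaleC (a * b) x"
    and scaleC_one: "scaleC 1 x = x"
    and scaleR_scaleC: "scaleR r x = scaleC (complex_of_real r) x"
    and cinner_commute: "cinner x y = cnj (cinner y x)"
    and cinner_add_left: "cinner (x + y) z = cinner x z + cinner y z"
    and cinner_scaleC_left: "cinner (scaleC a x) y = a * cinner x y"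
    and cinner_ge_zero: "0 \<le> Re (cinner x x)"
    and norm_eq_sqrt_cinner: "norm x = sqrt (Re (cinner x x))"

class complex_hilbert = complex_inner + complete_space

global_interpretation complex_vec: vector_space "scaleC :: complex \<Rightarrow> 'a \<Rightarrow> 'a::complex_inner"
  by unfold_locales
    (auto simp: scaleC_add_right scaleC_add_left scaleC_scaleC scaleC_one)

text \<open>
  An operator in \<open>'a\<close> is a partial function \<open>A :: 'a \<rightharpoonup> 'a\<close> with domain \<^term>\<open>dom A\<close> and values
  \<^term>\<open>the (A f)\<close>. Inclusion \<open>S \<subseteq> T\<close> of operators is \<open>S \<subseteq>\<^sub>m T\<close>, the product \<open>ST\<close> with its
  natural domain is \<open>S \<circ>\<^sub>m T\<close>, and an everywhere defined operator \<open>P :: 'a \<Rightarrow> 'a\<close> is regarded as the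
  partial function \<open>Some \<circ> P\<close>.
\<close>

definition linear_operator :: "('a::complex_inner \<rightharpoonup> 'a) \<Rightarrow> bool" where
  "linear_operator A \<longleftrightarrow>
     complex_vec.subspace (dom A) \<and>
     (\<forall>f\<in>dom A. \<forall>g\<in>dom A. the (A (f + g)) = the (A f) + the (A g)) \<and>
     (\<forall>c. \<forall>f\<in>dom A. the (A (scaleC c f)) = scaleC c (the (A f)))"

definition densely_defined :: "('a::complex_inner \<rightharpoonup> 'a) \<Rightarrow> bool" where
  "densely_defined A \<longleftrightarrow> closure (dom A) = UNIV"

definition closed_operator :: "('a::complex_inner \<rightharpoonup> 'a) \<Rightarrow> bool" where
  "closed_operator A \<longleftrightarrow> linear_operator A \<and> closed (Map.graph A)"

text \<open>For densely defined \<open>A\<close> the vector \<open>h\<close> below is unique.\<close>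

definition adjoint_operator :: "('a::complex_inner \<rightharpoonup> 'a) \<Rightarrow> ('a \<rightharpoonup> 'a)" where
  "adjoint_operator A g =
     (if \<exists>h. \<forall>f\<in>dom A. cinner (the (A f)) g = cinner f h
      then Some (THE h. \<forall>f\<in>dom A. cinner (the (A f)) g = cinner f h)
      else None)"

definition selfadjoint_operator :: "('a::complex_inner \<rightharpoonup> 'a) \<Rightarrow> bool" where
  "selfadjoint_operator T \<longleftrightarrow>
     linear_operator T \<and> densely_defined T \<and> adjoint_operator T = T"

definition positive_operator :: "('a::complex_inner \<rightharpoonup> 'a) \<Rightarrow> bool" where
  "positive_operator T \<longleftrightarrow>
     (\<forall>f\<in>dom T. cinner (the (T f)) f \<in> \<real> \<and> 0 \<le> Re (cinner (the (T f)) f))"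

text \<open>\<open>T = |A|\<close>, the positive selfadjoint square root of \<open>A\<^sup>*A\<close>.\<close>

definition is_modulus :: "('a::complex_inner \<rightharpoonup> 'a) \<Rightarrow> ('a \<rightharpoonup> 'a) \<Rightarrow> bool" where
  "is_modulus A T \<longleftrightarrow>
     selfadjoint_operator T \<and> positive_operator T \<and>
     T \<circ>\<^sub>m T = adjoint_operator A \<circ>\<^sub>m A"

definition orthogonal_projection :: "('a::complex_inner \<Rightarrow> 'a) \<Rightarrow> bool" where
  "orthogonal_projection P \<longleftrightarrow>
     Vector_Spaces.linear scaleC scaleC P \<and> P \<circ> P = P \<and>
     (\<forall>x y. cinner (P x) y = cinner x (P y))"

abbreviation borel_nonneg :: "real measure" where
  "borel_nonneg \<equiv> restrict_space borel {0..}"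

text \<open>Only the values of \<open>E\<close> on Borel subsets of \<open>[0,\<infinity>)\<close> matter; countable additivity is in the strong
  operator topology.\<close>

definition spectral_measure :: "(real set \<Rightarrow> 'a::complex_inner \<Rightarrow> 'a) \<Rightarrow> bool" where
  "spectral_measure E \<longleftrightarrow>
     (\<forall>\<sigma>\<in>sets borel_nonneg. orthogonal_projection (E \<sigma>)) \<and>
     E {0..} = id \<and>
     (\<forall>F :: nat \<Rightarrow> real set. range F \<subseteq> sets borel_nonneg \<longrightarrow> disjoint_family F \<longrightarrow>
        (\<forall>h. (\<lambda>n. E (F n) h) sums E (\<Union>n. F n) h))"

text \<open>The measure \<open>\<sigma> \<mapsto> \<langle>E(\<sigma>)h, h\<rangle>\<close> on the Borel subsets of \<open>[0,\<infinity>)\<close>.\<close>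

definition spectral_dist :: "(real set \<Rightarrow> 'a::complex_inner \<Rightarrow> 'a) \<Rightarrow> 'a \<Rightarrow> real measure" where
  "spectral_dist E h =
     measure_of {0..} (sets borel_nonneg) (\<lambda>\<sigma>. ennreal (Re (cinner (E \<sigma> h) h)))"

lemma emeasure_spectral_dist:
  assumes E: "spectral_measure E" and \<sigma>: "\<sigma> \<in> sets borel_nonneg"
  shows "emeasure (spectral_dist E h) \<sigma> = ennreal (Re (cinner (E \<sigma> h) h))"
proof -
  have proj: "cinner (E s h) h = cinner (E s h) (E s h)" if "s \<in> sets borel_nonneg" for s
    using E that unfolding spectral_measure_def orthogonal_projection_def
    by (metis comp_apply)
  have nn: "Re (cinner (E s h) h) \<ge> 0" if "s \<in> sets borel_nonneg" for s
    using proj[OF that] cinner_ge_zero[of "E s h"] by simp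
  have sq: "Re (cinner x x) = (norm x)\<^sup>2" for x :: 'a
    by (simp add: norm_eq_sqrt_cinner cinner_ge_zero)
  have polar: "Re (cinner x h) = ((norm (x + h))\<^sup>2 - (norm x)\<^sup>2 - (norm h)\<^sup>2) / 2" for x
  proof -
    have r: "cinner z (x + y) = cinner z x + cinner z y" for x y z :: 'a
      by (subst (1 2 3) cinner_commute) (simp add: cinner_add_left)
    have "Re (cinner h x) = Re (cinner x h)" by (subst cinner_commute) simp
    then show ?thesis unfolding sq[symmetric] by (simp add: cinner_add_left r)
  qed
  have add: "Re (cinner (sum f S) h) = (\<Sum>i\<in>S. Re (cinner (f i) h))" if "finite S" for f and S :: "nat set"
    using that
  proof (induction S)
    case empty show ?case using cinner_add_left[of 0 0 h] by simp
  qed (simp add: cinner_add_left)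
  have sums: "(\<lambda>n. Re (cinner (E (F n) h) h)) sums Re (cinner (E (\<Union>n. F n) h) h)"
    if "range F \<subseteq> sets borel_nonneg" "disjoint_family F" for F :: "nat \<Rightarrow> real set"
  proof -
    have s: "(\<lambda>n. \<Sum>i<n. E (F i) h) \<longlonglongrightarrow> E (\<Union>n. F n) h"
      using E that unfolding spectral_measure_def sums_def by blast
    show ?thesis unfolding sums_def add[OF finite_lessThan, symmetric]
      unfolding polar by (intro tendsto_intros s) auto
  qed
  have 0: "E {} h = 0"
  proof -
    have "(\<lambda>n. E {} h) sums E {} h"
      using E unfolding spectral_measure_def
      by (auto dest!: spec[of _ "\<lambda>_::nat. {}"] simp: disjoint_family_on_def)
    then show ?thesis by (metis sums_summable summable_const_iff)
  qed
  have c0: "cinner 0 h = 0" using cinner_add_left[of 0 0 h] by simp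
  show ?thesis
  proof (rule emeasure_measure_of[OF spectral_dist_def])
    show "sets borel_nonneg \<subseteq> Pow {0..}" using sets.sets_into_space[of _ borel_nonneg] by auto
    have eq: "sets (spectral_dist E h) = sets borel_nonneg"
      unfolding spectral_dist_def
      by (metis sets.sets_measure_of_eq space_restrict_space space_borel Int_UNIV_right)
    show "\<sigma> \<in> sets (spectral_dist E h)" using \<sigma> eq by simp
    show "positive (sets (spectral_dist E h)) (\<lambda>\<sigma>. ennreal (Re (cinner (E \<sigma> h) h)))"
      by (simp add: positive_def 0 c0)
    show "countably_additive (sets (spectral_dist E h)) (\<lambda>\<sigma>. ennreal (Re (cinner (E \<sigma> h) h)))"
      unfolding countably_additive_def eq
    proof (intro allI impI)
      fix F :: "nat \<Rightarrow> real set"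
      assume F: "range F \<subseteq> sets borel_nonneg" "disjoint_family F"
      note S = sums[OF F]
      have "(\<Sum>i. ennreal (Re (cinner (E (F i) h) h))) = ennreal (\<Sum>i. Re (cinner (E (F i) h) h))"
        by (rule suminf_ennreal2) (use F nn sums_summable[OF S] in auto)
      then show "(\<Sum>i. ennreal (Re (cinner (E (F i) h) h))) = ennreal (Re (cinner (E (\<Union> (range F)) h) h))"
        using sums_unique[OF S] by simp
    qed
  qed
qed

text \<open>
  \<open>E\<close> is the spectral measure of the positive selfadjoint operator \<open>T\<close>, that is \<open>T = \<integral> t dE(t)\<close>: the
  domain of the integral consists of all \<open>h\<close> with \<open>\<integral> t\<^sup>2 d\<langle>E(t)h, h\<rangle> < \<infinity>\<close>, and its values are
  given weakly by \<open>\<langle>Th, h\<rangle> = \<integral> t d\<langle>E(t)h, h\<rangle>\<close> (off the diagonal by polarization).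
\<close>

definition is_spectral_measure_of ::
    "(real set \<Rightarrow> 'a::complex_inner \<Rightarrow> 'a) \<Rightarrow> ('a \<rightharpoonup> 'a) \<Rightarrow> bool" where
  "is_spectral_measure_of E T \<longleftrightarrow>
     spectral_measure E \<and>
     dom T = {h. (\<integral>\<^sup>+ t. ennreal (t\<^sup>2) \<partial>spectral_dist E h) < \<infinity>} \<and>
     (\<forall>h\<in>dom T. cinner (the (T h)) h = complex_of_real (\<integral> t. t \<partial>spectral_dist E h))"

text \<open>
  The modulus of a closed densely defined operator and its spectral measure exist and are unique, so the
  existential quantifier only names them.
\<close>

definition quasinormal :: "('a::complex_hilbert \<rightharpoonup> 'a) \<Rightarrow> bool" where
  "quasinormal A \<longleftrightarrow>
     closed_operator A \<and> densely_defined A \<and>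
     (\<exists>T E. is_modulus A T \<and> is_spectral_measure_of E T \<and>
        (\<forall>\<sigma>\<in>sets borel_nonneg. (Some \<circ> E \<sigma>) \<circ>\<^sub>m A \<subseteq>\<^sub>m A \<circ>\<^sub>m (Some \<circ> E \<sigma>)))"

end

theory Submission
  imports Defs
begin

text \<open>
  If \<open>\<sigma>\<close> and \<open>\<tau>\<close> are disjoint, then \<open>E(\<tau>)|A|E(\<sigma>) = 0\<close>. Under (iii) absolute continuity turns
  this into \<open>E(\<tau>)AE(\<sigma>) = 0\<close>, which for \<open>\<tau>\<close> the complement of \<open>\<sigma>\<close>, and with the roles exchanged,
  says that \<open>E(\<sigma>)\<close> commutes with \<open>A\<close>. Conversely, if \<open>E(\<sigma>)\<close> commutes with \<open>A\<close>, then
  \<open>\<parallel>E(\<sigma>)Af\<parallel> = \<parallel>AE(\<sigma>)f\<parallel> = \<parallel>|A|E(\<sigma>)f\<parallel> = \<parallel>E(\<sigma>)|A|f\<parallel>\<close>, which is (ii).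

  The identity \<open>\<parallel>Af\<parallel> = \<parallel>|A|f\<parallel>\<close> on \<open>\<D>(A) = \<D>(|A|)\<close> is obtained from the vectors
  \<open>E([0,n))f\<close>, on which \<open>A\<^sup>*A = |A|\<^sup>2\<close> is available. Since the definition of quasinormality quantifies
  over the spectral measure, \<open>E\<close> has to be determined by \<open>A\<^sup>*A\<close>: the range of \<open>E([0,a])\<close> consists of
  the vectors \<open>h\<close> with \<open>\<parallel>(A\<^sup>*A)\<^sup>kh\<parallel> \<le> a\<^bsup>2k\<^esup>\<parallel>h\<parallel>\<close> for all \<open>k\<close>.
\<close>

section \<open>Inner products\<close>

lemma cinner_add_right: "cinner x (y + z) = cinner x y + cinner x (z :: 'a::complex_inner)"
  by (subst (1 2 3) cinner_commute) (simp add: cinner_add_left)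

lemma cinner_scaleC_right: "cinner x (scaleC a y) = cnj a * cinner x (y :: 'a::complex_inner)"
  by (subst (1 2) cinner_commute) (simp add: cinner_scaleC_left)

lemma cinner_self: "cinner x x = complex_of_real ((norm (x :: 'a::complex_inner))\<^sup>2)"
proof -
  have "Im (cinner x x) = 0"
    using arg_cong[OF cinner_commute[of x x], of Im] by simp
  then show ?thesis
    by (simp add: complex_eq_iff norm_eq_sqrt_cinner cinner_ge_zero)
qed

text \<open>The minimum over t is attained at t = -q/r. The degenerate case r = 0 is kept because
  the lemma serves two forms: the inner product itself and, in \<open>norm_T_le\<close>, the form
  <Tx, y>, which may vanish on nonzero vectors.\<close>

lemma quadratic_nonneg_discriminant:
  fixes p q r :: real
  assumes "\<And>t. 0 \<le> p + 2 * t * q + t\<^sup>2 * r" and "0 \<le> r"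
  shows "q\<^sup>2 \<le> p * r"
proof (cases "r = 0")
  case True
  have "q = 0"
  proof (rule ccontr)
    assume "q \<noteq> 0"
    \<comment> \<open>At this t the affine function p + 2tq takes the value -1.\<close>
    then show False
      using assms(1)[of "- (p + 1) / (2 * q)"] True by (simp add: field_simps)
  qed
  then show ?thesis using True by simp
next
  case False
  then have "r > 0" using assms(2) by simp
  then have "p + 2 * (- q / r) * q + (- q / r)\<^sup>2 * r = (p * r - q\<^sup>2) / r"
    by (simp add: field_simps power2_eq_square)
  then have "0 \<le> (p * r - q\<^sup>2) / r" using assms(1)[of "- q / r"] by simp
  then show ?thesis using \<open>r > 0\<close> by (simp add: zero_le_divide_iff)
qed

lemma Re_cinner_le: "\<bar>Re (cinner x y)\<bar> \<le> norm x * norm (y :: 'a::complex_inner)"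
proof -
  have "0 \<le> (norm x)\<^sup>2 + 2 * t * Re (cinner x y) + t\<^sup>2 * (norm y)\<^sup>2" for t
  proof -
    have "Re (cinner y x) = Re (cinner x y)" by (subst cinner_commute) simp
    moreover have "Re (cinner z z) = (norm z)\<^sup>2" for z :: 'a
      unfolding cinner_self by simp
    ultimately have "Re (cinner (x + scaleR t y) (x + scaleR t y))
        = (norm x)\<^sup>2 + 2 * t * Re (cinner x y) + t\<^sup>2 * (norm y)\<^sup>2"
      unfolding cinner_add_left cinner_add_right scaleR_scaleC cinner_scaleC_left cinner_scaleC_right
      by (simp add: power2_eq_square[of t] algebra_simps)
    then show ?thesis by (metis cinner_ge_zero)
  qed
  from quadratic_nonneg_discriminant[OF this] have "(Re (cinner x y))\<^sup>2 \<le> (norm x * norm y)\<^sup>2"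
    by (simp add: power_mult_distrib)
  then have "\<bar>Re (cinner x y)\<bar> \<le> \<bar>norm x * norm y\<bar>" unfolding abs_le_square_iff .
  then show ?thesis by simp
qed

lemma norm_scaleC: "norm (scaleC c x) = cmod c * norm (x :: 'a::complex_inner)"
proof -
  have "cinner (scaleC c x) (scaleC c x) = complex_of_real ((cmod c)\<^sup>2 * (norm x)\<^sup>2)"
    unfolding cinner_scaleC_left cinner_scaleC_right cinner_self[of x] of_real_mult complex_norm_square
    by (simp only: mult_ac)
  then have "(norm (scaleC c x))\<^sup>2 = (cmod c * norm x)\<^sup>2"
    unfolding cinner_self of_real_eq_iff by (simp add: power_mult_distrib)
  then show ?thesis by simp
qed

lemma cmod_cinner_le: "cmod (cinner x y) \<le> norm x * norm (y :: 'a::complex_inner)"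
proof (cases "cinner x y = 0")
  case False
  \<comment> \<open>Multiplying by the unimodular c turns the inner product into its modulus, so the
    bound for real parts applies.\<close>
  define c where "c = cnj (sgn (cinner x y))"
  have "cmod c = 1" using False by (simp add: c_def norm_sgn)
  have "cinner (scaleC c x) y = cmod (cinner x y)"
    by (simp add: cinner_scaleC_left c_def sgn_eq mult.commute complex_norm_square[symmetric] power2_eq_square)
  then have "cmod (cinner x y) = Re (cinner (scaleC c x) y)" by simp
  also have "\<dots> \<le> norm (scaleC c x) * norm y" using Re_cinner_le by (rule abs_le_D1)
  finally show ?thesis by (simp add: norm_scaleC \<open>cmod c = 1\<close>)
qed simp

lemma bounded_bilinear_cinner: "bounded_bilinear (cinner :: 'a::complex_inner \<Rightarrow> 'a \<Rightarrow> complex)"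
proof
  show "\<exists>K. \<forall>a b :: 'a. norm (cinner a b) \<le> norm a * norm b * K"
    by (intro exI[of _ 1]) (simp add: cmod_cinner_le)
qed (simp_all add: cinner_add_left cinner_add_right scaleR_scaleC cinner_scaleC_left
    cinner_scaleC_right scaleR_conv_of_real)

interpretation cinner: bounded_bilinear "cinner :: 'a::complex_inner \<Rightarrow> 'a \<Rightarrow> complex"
  by (rule bounded_bilinear_cinner)

declare cinner.zero_left [simp] cinner.zero_right [simp]

text \<open>x - y is itself a limit of vectors of D, each orthogonal to it, so it is orthogonal to
  itself. This gives uniqueness of the values of an adjoint.\<close>

lemma dense_cinner_eqI:
  fixes x y :: "'a::complex_inner"
  assumes D: "closure D = UNIV" and eq: "\<And>w. w \<in> D \<Longrightarrow> cinner w x = cinner w y"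
  shows "x = y"
proof -
  obtain w where w: "\<And>n. w n \<in> D" and lim: "w \<longlonglongrightarrow> x - y"
    using D closure_sequential[of "x - y" D] by auto
  have "(\<lambda>n. cinner (w n) (x - y)) \<longlonglongrightarrow> cinner (x - y) (x - y)"
    by (intro cinner.tendsto lim tendsto_const)
  moreover have "cinner (w n) (x - y) = 0" for n
    using eq[OF w] by (simp add: cinner.diff_right)
  ultimately have "cinner (x - y) (x - y) = 0" by (simp add: LIMSEQ_const_iff)
  then show ?thesis by (simp add: cinner_self)
qed

lemma cinner_eqI: "(\<And>w. cinner w x = cinner w y) \<Longrightarrow> x = (y :: 'a::complex_inner)"
  by (rule dense_cinner_eqI[of UNIV]) auto

lemma norm_add_sqr_orthogonal:
  assumes "cinner x y = 0"
  shows "(norm (x + y))\<^sup>2 = (norm x)\<^sup>2 + (norm (y :: 'a::complex_inner))\<^sup>2"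
proof -
  have "cinner y x = 0" by (subst cinner_commute) (simp add: assms)
  then have "cinner (x + y) (x + y) = cinner x x + cinner y y"
    using assms by (simp add: cinner_add_left cinner_add_right)
  then show ?thesis unfolding cinner_self by (metis of_real_add of_real_eq_iff)
qed

text \<open>The squared norms increase and are bounded, hence form a Cauchy sequence;
  \<open>inc\<close> carries this over to the vectors.\<close>

lemma Cauchy_orthogonal_increments:
  fixes x :: "nat \<Rightarrow> 'a::real_normed_vector"
  assumes inc: "\<And>m n. m \<le> n \<Longrightarrow> (norm (x n - x m))\<^sup>2 = (norm (x n))\<^sup>2 - (norm (x m))\<^sup>2"
    and bound: "\<And>n. norm (x n) \<le> C"
  shows "Cauchy x"
proof -
  define q where "q n = (norm (x n))\<^sup>2" for n
  have "incseq q"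
    unfolding incseq_def q_def using inc by (metis diff_ge_0_iff_ge zero_le_power2)
  moreover have "q n \<le> C\<^sup>2" for n
    unfolding q_def using bound by (intro power_mono) auto
  ultimately have "convergent q" using incseq_convergent by (metis convergentI)
  then have q: "Cauchy q" by (rule convergent_Cauchy)
  show ?thesis
  proof (rule CauchyI')
    fix e :: real assume e: "0 < e"
    then obtain M where M: "\<And>m n. m \<ge> M \<Longrightarrow> n \<ge> M \<Longrightarrow> dist (q m) (q n) < e\<^sup>2"
      using metric_CauchyD[OF q, of "e\<^sup>2"] by auto
    have "dist (x m) (x n) < e" if "m \<ge> M" "n > m" for m n
    proof -
      have "(norm (x n - x m))\<^sup>2 = q n - q m" using inc[of m n] that by (simp add: q_def)
      also have "\<dots> < e\<^sup>2" using M[of m n] that by (simp add: dist_real_def)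
      finally show ?thesis
        using e by (metis dist_commute dist_norm less_imp_le power2_less_imp_less)
    qed
    then show "\<exists>M. \<forall>m\<ge>M. \<forall>n>m. dist (x m) (x n) < e" by blast
  qed
qed

section \<open>Operators and orthogonal projections\<close>

lemma linear_operator_simps:
  assumes "linear_operator A"
  shows linear_operator_dom_add: "f \<in> dom A \<Longrightarrow> g \<in> dom A \<Longrightarrow> f + g \<in> dom A"
    and linear_operator_dom_scaleC: "f \<in> dom A \<Longrightarrow> scaleC c f \<in> dom A"
    and linear_operator_add: "f \<in> dom A \<Longrightarrow> g \<in> dom A \<Longrightarrow> the (A (f + g)) = the (A f) + the (A g)"
    and linear_operator_scaleC: "f \<in> dom A \<Longrightarrow> the (A (scaleC c f)) = scaleC c (the (A f))"
  using assms unfolding linear_operator_def complex_vec.subspace_def by simp_all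

lemma scaleC_minus1: "scaleC (- 1) x = - (x :: 'a::complex_inner)"
  using scaleR_scaleC[of "- 1" x] by simp

lemma linear_operator_diff:
  assumes A: "linear_operator A" and "f \<in> dom A" "g \<in> dom A"
  shows "f - g \<in> dom A" "the (A (f - g)) = the (A f) - the (A g)"
proof -
  have g: "- g \<in> dom A" "the (A (- g)) = - the (A g)"
    using linear_operator_dom_scaleC[OF A, of g "- 1"] linear_operator_scaleC[OF A, of g "- 1"] assms(3)
    by (simp_all add: scaleC_minus1)
  then show "f - g \<in> dom A" "the (A (f - g)) = the (A f) - the (A g)"
    using linear_operator_dom_add[OF A assms(2) g(1)] linear_operator_add[OF A assms(2) g(1)]
    by simp_all
qed

text \<open>Density makes the vector selected by \<open>THE\<close> unique, so the graph of the
  adjoint is described by the defining identity alone.\<close>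

lemma adjoint_operator_eq_Some_iff:
  assumes "densely_defined A"
  shows "adjoint_operator A g = Some h \<longleftrightarrow> (\<forall>f\<in>dom A. cinner (the (A f)) g = cinner f h)"
proof -
  have uniq: "h = h'"
    if "\<forall>f\<in>dom A. cinner (the (A f)) g = cinner f h" "\<forall>f\<in>dom A. cinner (the (A f)) g = cinner f h'"
    for h h'
    using assms that unfolding densely_defined_def by (intro dense_cinner_eqI[of "dom A"]) auto
  have Some: "adjoint_operator A g = Some h" if "\<forall>f\<in>dom A. cinner (the (A f)) g = cinner f h" for h
  proof -
    have "(THE h. \<forall>f\<in>dom A. cinner (the (A f)) g = cinner f h) = h"
      using uniq that by (intro the_equality)
    moreover have "\<exists>h. \<forall>f\<in>dom A. cinner (the (A f)) g = cinner f h"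
      using that by blast
    ultimately show ?thesis unfolding adjoint_operator_def by (simp only: if_True)
  qed
  show ?thesis
  proof
    assume *: "adjoint_operator A g = Some h"
    then obtain h' where h': "\<forall>f\<in>dom A. cinner (the (A f)) g = cinner f h'"
      unfolding adjoint_operator_def by (auto split: if_splits)
    then show "\<forall>f\<in>dom A. cinner (the (A f)) g = cinner f h"
      using Some[OF h'] * by simp
  qed (rule Some)
qed

lemma orthogonal_projectionD:
  assumes "orthogonal_projection P"
  shows orthogonal_projection_add: "P (x + y) = P x + P y"
    and orthogonal_projection_diff: "P (x - y) = P x - P y"
    and orthogonal_projection_scaleC: "P (scaleC c x) = scaleC c (P x)"
    and orthogonal_projection_idem: "P (P x) = P x"
    and orthogonal_projection_symmetric: "cinner (P x) y = cinner x (P y)"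
proof -
  interpret Vector_Spaces.linear scaleC scaleC P
    using assms unfolding orthogonal_projection_def by blast
  show "P (x + y) = P x + P y" "P (x - y) = P x - P y" "P (scaleC c x) = scaleC c (P x)"
    by (simp_all add: add diff scale)
  show "P (P x) = P x" "cinner (P x) y = cinner x (P y)"
    using assms unfolding orthogonal_projection_def by (simp_all add: fun_eq_iff)
qed

lemma cinner_orthogonal_projection:
  assumes "orthogonal_projection P"
  shows "cinner (P x) x = complex_of_real ((norm (P x))\<^sup>2)"
  using orthogonal_projection_symmetric[OF assms, of "P x" x] cinner_self[of "P x"]
  by (simp add: orthogonal_projection_idem[OF assms])

lemma norm_orthogonal_projection_diff:
  assumes P: "orthogonal_projection P"
  shows "(norm (x - P x))\<^sup>2 = (norm x)\<^sup>2 - (norm (P x))\<^sup>2"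
proof -
  have "cinner (P x) (x - P x) = 0"
    by (simp add: orthogonal_projection_symmetric[OF P] orthogonal_projection_diff[OF P]
        orthogonal_projection_idem[OF P])
  from norm_add_sqr_orthogonal[OF this] show ?thesis by simp
qed

text \<open>Each projection fixes the range of the other: QP = P and PQ = Q. Passing to adjoints in
  the first identity gives P = PQ = Q.\<close>

lemma orthogonal_projection_eqI:
  assumes P: "orthogonal_projection P" and Q: "orthogonal_projection Q" and eq: "range P = range Q"
  shows "P = Q"
proof
  fix x
  have PQ: "P (Q y) = Q y" and QP: "Q (P y) = P y" for y
    using eq orthogonal_projection_idem[OF P] orthogonal_projection_idem[OF Q] by (metis rangeE rangeI)+
  show "P x = Q x"
  proof (rule cinner_eqI)
    fix w
    have "cinner w (P x) = cinner w (Q (P x))" by (simp add: QP)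
    also have "\<dots> = cinner (P (Q w)) x"
      by (simp add: orthogonal_projection_symmetric[OF P] orthogonal_projection_symmetric[OF Q])
    also have "\<dots> = cinner w (Q x)" by (simp add: PQ orthogonal_projection_symmetric[OF Q])
    finally show "cinner w (P x) = cinner w (Q x)" .
  qed
qed

text \<open>By Pythagoras a projection fixes exactly the vectors whose norm it preserves, so the
  norms determine the range. This passes from the scalar measures <E(.)h, h> back to E.\<close>

lemma orthogonal_projection_norm_eqI:
  assumes P: "orthogonal_projection P" and Q: "orthogonal_projection Q"
    and eq: "\<And>x. norm (P x) = norm (Q x)"
  shows "P = Q"
proof (rule orthogonal_projection_eqI[OF P Q])
  have fixed_iff: "R x = x \<longleftrightarrow> norm (R x) = norm x" if "orthogonal_projection R" for R and x :: 'a
    using norm_orthogonal_projection_diff[OF that, of x] by auto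
  have eq_iff: "P x = x \<longleftrightarrow> Q x = x" for x
    using fixed_iff[OF P] fixed_iff[OF Q] eq by metis
  have "range R = {x. R x = x}" if "orthogonal_projection R" for R :: "'a \<Rightarrow> 'a"
    using orthogonal_projection_idem[OF that] by (auto simp: image_iff) metis
  from this[OF P] this[OF Q] show "range P = range Q" by (simp add: eq_iff)
qed

section \<open>Spectral measures\<close>

lemma sets_borel_nonneg_iff: "\<sigma> \<in> sets borel_nonneg \<longleftrightarrow> \<sigma> \<in> sets borel \<and> \<sigma> \<subseteq> {0..}"
  by (subst sets_restrict_space_iff) auto

lemma Diff_sets_borel_nonneg: "\<sigma> \<in> sets borel_nonneg \<Longrightarrow> {0..} - \<sigma> \<in> sets borel_nonneg"
  by (auto simp: sets_borel_nonneg_iff)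

locale spectral =
  fixes E :: "real set \<Rightarrow> 'a::complex_inner \<Rightarrow> 'a"
  assumes spectral_measure: "spectral_measure E"
begin

lemma proj: "\<sigma> \<in> sets borel_nonneg \<Longrightarrow> orthogonal_projection (E \<sigma>)"
  and E_space: "E {0..} h = h"
  using spectral_measure unfolding spectral_measure_def by simp_all

lemma E_sums:
  "range F \<subseteq> sets borel_nonneg \<Longrightarrow> disjoint_family F \<Longrightarrow> (\<lambda>n. E (F n) h) sums E (\<Union>n. F n) h"
  for F :: "nat \<Rightarrow> real set"
  using spectral_measure unfolding spectral_measure_def by blast

lemmas E_add = orthogonal_projection_add[OF proj]
  and E_diff = orthogonal_projection_diff[OF proj]
  and E_scaleC = orthogonal_projection_scaleC[OF proj]
  and E_idem = orthogonal_projection_idem[OF proj]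
  and E_symmetric = orthogonal_projection_symmetric[OF proj]
  and cinner_E = cinner_orthogonal_projection[OF proj]
  and norm_E_diff = norm_orthogonal_projection_diff[OF proj]

lemma norm_E_le:
  assumes "\<sigma> \<in> sets borel_nonneg"
  shows "norm (E \<sigma> h) \<le> norm h"
proof (rule power2_le_imp_le)
  show "(norm (E \<sigma> h))\<^sup>2 \<le> (norm h)\<^sup>2"
    using norm_E_diff[OF assms, of h] zero_le_power2[of "norm (h - E \<sigma> h)"] by linarith
qed simp

lemma E_empty: "E {} h = 0"
proof -
  have "(\<lambda>n::nat. E {} h) sums E {} h"
    using E_sums[of "\<lambda>_. {}" h] by (simp add: disjoint_family_on_def)
  then show ?thesis by (metis sums_summable summable_const_iff)
qed

lemma E_Un:
  assumes "\<sigma> \<in> sets borel_nonneg" "\<tau> \<in> sets borel_nonneg" "\<sigma> \<inter> \<tau> = {}"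
  shows "E (\<sigma> \<union> \<tau>) h = E \<sigma> h + E \<tau> h"
proof -
  have "(\<lambda>n. E (binaryset \<sigma> \<tau> n) h) sums E (\<Union>n. binaryset \<sigma> \<tau> n) h"
    using assms by (intro E_sums) (auto simp: binaryset_def disjoint_family_on_def)
  moreover have "(\<lambda>n. E (binaryset \<sigma> \<tau> n) h) sums (\<Sum>n\<in>{0, Suc 0}. E (binaryset \<sigma> \<tau> n) h)"
    by (intro sums_finite) (auto simp: binaryset_def E_empty)
  ultimately have "E (\<Union>n. binaryset \<sigma> \<tau> n) h = (\<Sum>n\<in>{0, Suc 0}. E (binaryset \<sigma> \<tau> n) h)"
    by (rule sums_unique2)
  then show ?thesis unfolding UN_binaryset_eq by (simp add: binaryset_def)
qed

lemma E_split: "\<sigma> \<in> sets borel_nonneg \<Longrightarrow> E \<sigma> h + E ({0..} - \<sigma>) h = h"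
  using E_Un[of \<sigma> "{0..} - \<sigma>" h] Diff_sets_borel_nonneg[of \<sigma>]
  by (simp add: E_space sets_borel_nonneg_iff Un_absorb1)

text \<open>Orthogonality comes from additivity: for y in the range of \<open>E \<tau>\<close> the
  squared norm of \<open>E (\<sigma> \<union> \<tau>) y\<close> is that of
  \<open>E \<sigma> y\<close> plus that of y, yet a projection cannot exceed the squared norm of
  y.\<close>

lemma E_disjoint:
  assumes \<sigma>: "\<sigma> \<in> sets borel_nonneg" and \<tau>: "\<tau> \<in> sets borel_nonneg" and "\<sigma> \<inter> \<tau> = {}"
  shows "E \<sigma> (E \<tau> h) = 0"
proof -
  let ?y = "E \<tau> h"
  have Un: "\<sigma> \<union> \<tau> \<in> sets borel_nonneg" using \<sigma> \<tau> by (rule sets.Un)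
  have "cinner (E (\<sigma> \<union> \<tau>) ?y) ?y = cinner (E \<sigma> ?y) ?y + cinner (E \<tau> ?y) ?y"
    by (simp add: E_Un[OF assms] cinner_add_left)
  then have "(norm (E (\<sigma> \<union> \<tau>) ?y))\<^sup>2 = (norm (E \<sigma> ?y))\<^sup>2 + (norm ?y)\<^sup>2"
    unfolding cinner_E[OF \<sigma>] cinner_E[OF \<tau>] cinner_E[OF Un] E_idem[OF \<tau>]
      cinner_self of_real_add[symmetric] of_real_eq_iff .
  moreover have "(norm (E (\<sigma> \<union> \<tau>) ?y))\<^sup>2 \<le> (norm ?y)\<^sup>2"
    by (intro power_mono norm_E_le Un) simp
  ultimately show ?thesis by simp
qed

lemma E_Int:
  assumes \<sigma>: "\<sigma> \<in> sets borel_nonneg" and \<tau>: "\<tau> \<in> sets borel_nonneg"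
  shows "E \<sigma> (E \<tau> h) = E (\<sigma> \<inter> \<tau>) h"
proof -
  have I: "\<sigma> \<inter> \<tau> \<in> sets borel_nonneg" using \<sigma> \<tau> by (rule sets.Int)
  have D: "\<tau> - \<sigma> \<in> sets borel_nonneg" "\<sigma> - \<tau> \<in> sets borel_nonneg" using \<sigma> \<tau> by auto
  have un: "(\<sigma> \<inter> \<tau>) \<union> (\<tau> - \<sigma>) = \<tau>" "(\<sigma> \<inter> \<tau>) \<union> (\<sigma> - \<tau>) = \<sigma>" by blast+
  have disj: "(\<sigma> \<inter> \<tau>) \<inter> (\<tau> - \<sigma>) = {}" "\<sigma> \<inter> (\<tau> - \<sigma>) = {}" "(\<sigma> - \<tau>) \<inter> (\<sigma> \<inter> \<tau>) = {}" by blast+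
  have "E \<tau> h = E (\<sigma> \<inter> \<tau>) h + E (\<tau> - \<sigma>) h"
    using E_Un[OF I D(1) disj(1), of h] unfolding un .
  then have "E \<sigma> (E \<tau> h) = E \<sigma> (E (\<sigma> \<inter> \<tau>) h)"
    by (simp add: E_add[OF \<sigma>] E_disjoint[OF \<sigma> D(1) disj(2)])
  also have "\<dots> = E ((\<sigma> \<inter> \<tau>) \<union> (\<sigma> - \<tau>)) (E (\<sigma> \<inter> \<tau>) h)"
    unfolding un ..
  also have "\<dots> = E (\<sigma> \<inter> \<tau>) (E (\<sigma> \<inter> \<tau>) h) + E (\<sigma> - \<tau>) (E (\<sigma> \<inter> \<tau>) h)"
    by (rule E_Un[OF I D(2)]) blast
  also have "\<dots> = E (\<sigma> \<inter> \<tau>) h"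
    by (simp add: E_idem[OF I] E_disjoint[OF D(2) I disj(3)])
  finally show ?thesis .
qed

lemma E_commute:
  "\<sigma> \<in> sets borel_nonneg \<Longrightarrow> \<tau> \<in> sets borel_nonneg \<Longrightarrow> E \<sigma> (E \<tau> h) = E \<tau> (E \<sigma> h)"
  by (simp add: E_Int Int_commute)

lemma cinner_E_disjoint:
  assumes "\<sigma> \<in> sets borel_nonneg" "\<tau> \<in> sets borel_nonneg" "\<sigma> \<inter> \<tau> = {}"
  shows "cinner (E \<sigma> x) (E \<tau> y) = 0"
  using E_disjoint[OF assms, of y] by (simp add: E_symmetric[OF assms(1)])

text \<open>The half-open unit intervals partition the half-line, and their partial sums telescope
  to [0,n).\<close>

lemma E_lessThan_tendsto: "(\<lambda>n. E {0..<real n} h) \<longlonglongrightarrow> h"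
proof -
  let ?F = "\<lambda>n. {real n..<real (Suc n)}"
  have F: "?F n \<in> sets borel_nonneg" "{0..<real n} \<in> sets borel_nonneg" for n
    by (auto simp: sets_borel_nonneg_iff)
  have partial: "(\<Sum>i<n. E (?F i) h) = E {0..<real n} h" for n
  proof (induction n)
    case (Suc n)
    have "{0..<real n} \<union> ?F n = {0..<real (Suc n)}" by auto
    then show ?case using E_Un[OF F(2) F(1), of n n h] Suc by auto
  qed (simp add: E_empty)
  have UN: "(\<Union>n. ?F n) = {0..}"
  proof (intro set_eqI iffI)
    fix t :: real assume "t \<in> {0..}"
    then have "t \<in> ?F (nat \<lfloor>t\<rfloor>)" by simp linarith
    then show "t \<in> (\<Union>n. ?F n)" by blast
  qed auto
  have "disjoint_family ?F"
    unfolding disjoint_family_on_def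
  proof (intro ballI impI)
    fix m n :: nat assume "m \<noteq> n"
    then consider "real m + 1 \<le> real n" | "real n + 1 \<le> real m" by linarith
    then show "?F m \<inter> ?F n = {}" by cases auto
  qed
  then have "(\<lambda>n. E (?F n) h) sums E (\<Union>n. ?F n) h" using F by (intro E_sums) auto
  then show ?thesis unfolding sums_def partial UN E_space .
qed

section \<open>The scalar measures <E(.)h, h>\<close>

lemma sets_spectral_dist [simp]: "sets (spectral_dist E h) = sets borel_nonneg"
  unfolding spectral_dist_def
  by (metis sets.sets_measure_of_eq space_restrict_space space_borel Int_UNIV_right)

lemma space_spectral_dist [simp]: "space (spectral_dist E h) = {0..}"
  using sets_eq_imp_space_eq[OF sets_spectral_dist[of h]] by (simp add: space_restrict_space)

lemma emeasure_dist:
  "\<sigma> \<in> sets borel_nonneg \<Longrightarrow> emeasure (spectral_dist E h) \<sigma> = ennreal ((norm (E \<sigma> h))\<^sup>2)"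
  by (simp add: emeasure_spectral_dist[OF spectral_measure] cinner_E)

lemma borel_nonneg_space: "{0..} \<in> sets borel_nonneg"
  by (simp add: sets_borel_nonneg_iff)

lemma emeasure_dist_space: "emeasure (spectral_dist E h) {0..} = ennreal ((norm h)\<^sup>2)"
  by (simp add: emeasure_dist borel_nonneg_space E_space)

lemma measure_dist_space: "measure (spectral_dist E h) {0..} = (norm h)\<^sup>2"
  by (simp add: measure_def emeasure_dist_space)

lemma finite_measure_dist: "finite_measure (spectral_dist E h)"
  by (rule finite_measureI) (simp add: emeasure_dist_space)

lemma spectral_dist_eqI:
  assumes "\<And>\<sigma>. \<sigma> \<in> sets borel_nonneg \<Longrightarrow> norm (E \<sigma> u) = norm (E \<sigma> v)"
  shows "spectral_dist E u = spectral_dist E v"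
  by (rule measure_eqI) (simp_all add: emeasure_dist assms)

lemma measurable_dist [measurable]: "(\<lambda>t. t) \<in> borel_measurable (spectral_dist E h)"
  by (subst measurable_cong_sets[OF sets_spectral_dist refl]) (intro measurable_restrict_space1, simp)

lemma null_sets_dist:
  "\<sigma> \<in> null_sets (spectral_dist E h) \<longleftrightarrow> \<sigma> \<in> sets borel_nonneg \<and> E \<sigma> h = 0"
  by (auto simp: null_sets_def emeasure_dist)

text \<open>For h in the range of \<open>E \<sigma>\<close> the measure <E(.)h, h> is carried by
  \<sigma>, so bounds for t on \<sigma> become bounds for integrals.\<close>

lemma AE_spectral_dist:
  assumes \<sigma>: "\<sigma> \<in> sets borel_nonneg" and fixed: "E \<sigma> h = h"
  shows "AE t in spectral_dist E h. t \<in> \<sigma>"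
proof (rule AE_I')
  have "E ({0..} - \<sigma>) h = 0" using E_split[OF \<sigma>, of h] fixed by simp
  then show "{0..} - \<sigma> \<in> null_sets (spectral_dist E h)"
    by (simp add: null_sets_dist Diff_sets_borel_nonneg \<sigma>)
qed auto

end

section \<open>A selfadjoint operator is reduced by its spectral measure\<close>

locale spectral_operator = spectral E for E :: "real set \<Rightarrow> 'a::complex_hilbert \<Rightarrow> 'a" +
  fixes T :: "'a \<rightharpoonup> 'a"
  assumes selfadjoint: "selfadjoint_operator T"
    and spectral_measure_of: "is_spectral_measure_of E T"
begin

lemma linear: "linear_operator T" and dense: "densely_defined T" and adjoint: "adjoint_operator T = T"
  using selfadjoint unfolding selfadjoint_operator_def by auto

lemmas dom_add = linear_operator_dom_add[OF linear]
  and dom_scaleC = linear_operator_dom_scaleC[OF linear]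
  and dom_diff = linear_operator_diff(1)[OF linear]
  and T_add = linear_operator_add[OF linear]
  and T_scaleC = linear_operator_scaleC[OF linear]
  and T_diff = linear_operator_diff(2)[OF linear]

lemma in_dom_iff: "h \<in> dom T \<longleftrightarrow> (\<integral>\<^sup>+ t. ennreal (t\<^sup>2) \<partial>spectral_dist E h) < \<infinity>"
  and cinner_T: "h \<in> dom T \<Longrightarrow> cinner (the (T h)) h = complex_of_real (\<integral> t. t \<partial>spectral_dist E h)"
  using spectral_measure_of unfolding is_spectral_measure_of_def by auto

lemma symmetric:
  assumes "f \<in> dom T" "g \<in> dom T"
  shows "cinner (the (T f)) g = cinner f (the (T g))"
proof -
  have "adjoint_operator T g = Some (the (T g))" using assms adjoint by auto
  then show ?thesis using assms(1) by (simp add: adjoint_operator_eq_Some_iff[OF dense])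
qed

text \<open>Selfadjointness as maximality: T equals its adjoint, so every pair compatible with the
  symmetry of T already lies in its graph. Closedness of T follows in
  \<open>tendsto_graph\<close>.\<close>

lemma graphI: "(\<And>g. g \<in> dom T \<Longrightarrow> cinner (the (T g)) f = cinner g y) \<Longrightarrow> T f = Some y"
  using adjoint_operator_eq_Some_iff[OF dense, of f y] adjoint by simp

lemma tendsto_graph:
  assumes x: "x \<longlonglongrightarrow> f" and dom: "\<And>n. x n \<in> dom T" and y: "(\<lambda>n. the (T (x n))) \<longlonglongrightarrow> y"
  shows "T f = Some y"
proof (rule graphI)
  fix g assume g: "g \<in> dom T"
  have "(\<lambda>n. cinner (the (T g)) (x n)) \<longlonglongrightarrow> cinner (the (T g)) f"
    by (intro cinner.tendsto tendsto_const x)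
  moreover have "(\<lambda>n. cinner (the (T g)) (x n)) \<longlonglongrightarrow> cinner g y"
    unfolding symmetric[OF g dom] by (intro cinner.tendsto tendsto_const y)
  ultimately show "cinner (the (T g)) f = cinner g y" by (rule LIMSEQ_unique)
qed

text \<open>The spectral distribution of \<open>E(\<sigma>)h + c E(\<sigma>\<^sup>c)h\<close> does not depend on the unimodular
  scalar \<open>c\<close>, so polarization kills the cross terms.\<close>

lemma compress_dom_and_cross_term:
  assumes \<sigma>: "\<sigma> \<in> sets borel_nonneg" and h: "h \<in> dom T"
  shows "E \<sigma> h \<in> dom T" and "cinner (the (T (E \<sigma> h))) (E ({0..} - \<sigma>) h) = 0"
proof -
  define u where "u = E \<sigma> h"
  define v where "v = E ({0..} - \<sigma>) h"
  have \<sigma>': "{0..} - \<sigma> \<in> sets borel_nonneg" by (rule Diff_sets_borel_nonneg[OF \<sigma>])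
  have uv: "u + v = h" unfolding u_def v_def by (rule E_split[OF \<sigma>])
  have norm: "(norm (E \<tau> (u + scaleC c v)))\<^sup>2 = (norm (E \<tau> u))\<^sup>2 + (norm (E \<tau> v))\<^sup>2"
    if "cmod c = 1" "\<tau> \<in> sets borel_nonneg" for c \<tau>
  proof -
    have "cinner (E \<tau> u) (scaleC c (E \<tau> v)) = 0"
      unfolding u_def v_def E_commute[OF that(2) \<sigma>] E_commute[OF that(2) \<sigma>'] cinner_scaleC_right
      using cinner_E_disjoint[OF \<sigma> \<sigma>'] by simp
    from norm_add_sqr_orthogonal[OF this] show ?thesis
      using that by (simp add: E_add E_scaleC norm_scaleC)
  qed
  have dist: "spectral_dist E (u + scaleC c v) = spectral_dist E h" if "cmod c = 1" for c
  proof (rule spectral_dist_eqI)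
    fix \<tau> assume \<tau>: "\<tau> \<in> sets borel_nonneg"
    \<comment> \<open>The right-hand side is the case c = 1 of the same formula, since u + v =
      h.\<close>
    have "(norm (E \<tau> (u + scaleC c v)))\<^sup>2 = (norm (E \<tau> h))\<^sup>2"
      using norm[OF that \<tau>] norm[of 1, OF _ \<tau>] uv by simp
    then show "norm (E \<tau> (u + scaleC c v)) = norm (E \<tau> h)" by simp
  qed
  have dom: "u + scaleC c v \<in> dom T" if "cmod c = 1" for c
    using h unfolding in_dom_iff dist[OF that] .
  \<comment> \<open>Membership in the domain depends only on the distribution, so u + v and u - v
    both belong to it; u is their average.\<close>
  have "scaleC (1 / 2) (u + scaleC 1 v + (u + scaleC (- 1) v)) \<in> dom T"
    by (intro dom_scaleC dom_add dom) auto
  also have "scaleC (1 / 2) (u + scaleC 1 v + (u + scaleC (- 1) v)) = u"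
    using scaleR_scaleC[of "1 / 2" "u + u"] scaleR_half_double[of u]
    by (simp add: scaleC_minus1)
  finally have u: "u \<in> dom T" .
  have v: "v \<in> dom T" using dom_diff[OF h u] uv by auto
  let ?T = "\<lambda>x. the (T x)"
  define a where "a = cinner (?T u) v"
  define b where "b = cinner (?T v) u"
  \<comment> \<open>The quadratic form of T also depends only on the distribution, so its values at
    u + cv and u + v agree; the diagonal terms cancel.\<close>
  have cross: "cnj c * a + c * b = a + b" if "cmod c = 1" for c
  proof -
    have expand: "cinner (?T (u + scaleC d v)) (u + scaleC d v) =
        cinner (?T u) u + cnj d * a + d * b + cinner (?T v) v" if "cmod d = 1" for d
    proof -
      have "d * cnj d = 1" using that by (simp add: complex_norm_square[symmetric])
      then have "d * (cnj d * z) = z" for z by (simp add: mult.assoc[symmetric])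
      then show ?thesis
        using u v by (simp add: T_add dom_scaleC T_scaleC cinner_add_left cinner_add_right
            cinner_scaleC_left cinner_scaleC_right a_def b_def algebra_simps)
    qed
    have "cinner (?T (u + scaleC c v)) (u + scaleC c v) = cinner (?T (u + scaleC 1 v)) (u + scaleC 1 v)"
      using that by (simp only: cinner_T dom dist norm_one)
    then show ?thesis using expand[OF that] expand[of 1] by simp
  qed
  \<comment> \<open>c = -1 gives a + b = 0; then c = \<i> gives -2 \<i> a = 0.\<close>
  from cross[of "- 1"] have "b = - a" by (auto simp: complex_eq_iff)
  with cross[of \<i>] have "a = 0" by (simp add: complex_eq_iff)
  then show "E \<sigma> h \<in> dom T" "cinner (the (T (E \<sigma> h))) (E ({0..} - \<sigma>) h) = 0"
    using u by (simp_all add: u_def v_def a_def)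
qed

lemma E_dom: "\<sigma> \<in> sets borel_nonneg \<Longrightarrow> h \<in> dom T \<Longrightarrow> E \<sigma> h \<in> dom T"
  by (rule compress_dom_and_cross_term(1))

lemma T_range:
  assumes \<sigma>: "\<sigma> \<in> sets borel_nonneg" and h: "h \<in> dom T"
  shows "E ({0..} - \<sigma>) (the (T (E \<sigma> h))) = 0"
proof (rule dense_cinner_eqI[of "dom T"])
  show "closure (dom T) = UNIV" using dense unfolding densely_defined_def .
  fix w assume w: "w \<in> dom T"
  have \<sigma>': "{0..} - \<sigma> \<in> sets borel_nonneg" by (rule Diff_sets_borel_nonneg[OF \<sigma>])
  \<comment> \<open>The cross term is known to vanish only for the two parts of a single vector.
    Gluing the part of h in \<sigma> to the part of w outside \<sigma> makes w arbitrary.\<close>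
  let ?g = "E \<sigma> h + E ({0..} - \<sigma>) w"
  have "?g \<in> dom T" by (intro dom_add E_dom \<sigma> \<sigma>' h w)
  moreover have "E \<sigma> ?g = E \<sigma> h" "E ({0..} - \<sigma>) ?g = E ({0..} - \<sigma>) w"
    using E_disjoint[OF \<sigma> \<sigma>', of w] E_disjoint[OF \<sigma>' \<sigma> Diff_disjoint[THEN trans[OF Int_commute]], of h]
    by (simp_all add: E_add \<sigma> \<sigma>' E_idem)
  ultimately have "cinner (the (T (E \<sigma> h))) (E ({0..} - \<sigma>) w) = 0"
    using compress_dom_and_cross_term(2)[OF \<sigma>, of ?g] by simp
  then have "cinner (E ({0..} - \<sigma>) w) (the (T (E \<sigma> h))) = 0"
    by (subst cinner_commute) simp
  then show "cinner w (E ({0..} - \<sigma>) (the (T (E \<sigma> h)))) = cinner w 0"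
    by (simp add: E_symmetric[OF \<sigma>'])
qed

text \<open>Split h along \<sigma> and its complement and apply \<open>E \<sigma>\<close> to Th. By
  \<open>T_range\<close>, used for both sets, one summand vanishes and the other is fixed.\<close>

lemma T_E:
  assumes \<sigma>: "\<sigma> \<in> sets borel_nonneg" and h: "h \<in> dom T"
  shows "the (T (E \<sigma> h)) = E \<sigma> (the (T h))"
proof -
  have \<sigma>': "{0..} - \<sigma> \<in> sets borel_nonneg" by (rule Diff_sets_borel_nonneg[OF \<sigma>])
  have "{0..} - ({0..} - \<sigma>) = \<sigma>" using \<sigma> by (auto simp: sets_borel_nonneg_iff)
  then have 0: "E \<sigma> (the (T (E ({0..} - \<sigma>) h))) = 0" using T_range[OF \<sigma>' h] by simp
  have "the (T h) = the (T (E \<sigma> h)) + the (T (E ({0..} - \<sigma>) h))"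
    using T_add[OF E_dom[OF \<sigma> h] E_dom[OF \<sigma>' h]] by (simp add: E_split[OF \<sigma>])
  then have "E \<sigma> (the (T h)) = E \<sigma> (the (T (E \<sigma> h)))" by (simp add: E_add[OF \<sigma>] 0)
  also have "\<dots> = the (T (E \<sigma> h))"
    using E_split[OF \<sigma>, of "the (T (E \<sigma> h))"] T_range[OF \<sigma> h] by simp
  finally show ?thesis by simp
qed

section \<open>Bounds for T on spectral subspaces\<close>

lemma integrable_dist:
  assumes "h \<in> dom T"
  shows "integrable (spectral_dist E h) (\<lambda>t. t)"
proof (rule integrableI_bounded)
  \<comment> \<open>The integral of a non-integrable function defaults to 0, so integrability is
    needed before \<open>cinner_T\<close> yields estimates. Since the measure is finite, the second
    moment controls the first.\<close>
  have "(\<integral>\<^sup>+ t. ennreal (norm t) \<partial>spectral_dist E h) \<le> (\<integral>\<^sup>+ t. (1 + ennreal (t\<^sup>2)) \<partial>spectral_dist E h)"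
  proof (rule nn_integral_mono)
    fix t :: real
    have "0 \<le> (\<bar>t\<bar> - 1)\<^sup>2 + \<bar>t\<bar>" by simp
    then have "\<bar>t\<bar> \<le> 1 + t\<^sup>2" by (simp add: power2_eq_square algebra_simps)
    then show "ennreal (norm t) \<le> 1 + ennreal (t\<^sup>2)"
      by (simp add: ennreal_1[symmetric] ennreal_plus[symmetric] del: ennreal_1 ennreal_plus)
  qed
  also have "\<dots> = emeasure (spectral_dist E h) {0..} + (\<integral>\<^sup>+ t. ennreal (t\<^sup>2) \<partial>spectral_dist E h)"
    by (subst nn_integral_add) auto
  also have "\<dots> < \<infinity>" using assms by (simp add: emeasure_dist_space in_dom_iff)
  finally show "(\<integral>\<^sup>+ t. ennreal (norm t) \<partial>spectral_dist E h) < \<infinity>" .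
qed simp

lemma cinner_T_ge:
  assumes \<sigma>: "\<sigma> \<in> sets borel_nonneg" "\<sigma> \<subseteq> {b..}" and h: "h \<in> dom T" "E \<sigma> h = h"
  shows "b * (norm h)\<^sup>2 \<le> Re (cinner (the (T h)) h)"
proof -
  interpret finite_measure "spectral_dist E h" by (rule finite_measure_dist)
  have "(\<integral> t. b \<partial>spectral_dist E h) \<le> (\<integral> t. t \<partial>spectral_dist E h)"
    using AE_spectral_dist[OF \<sigma>(1) h(2)] \<sigma>(2)
    by (intro integral_mono_AE integrable_dist[OF h(1)]) auto
  then show ?thesis by (simp add: measure_dist_space cinner_T[OF h(1)] mult.commute)
qed

lemma cinner_T_le:
  assumes \<sigma>: "\<sigma> \<in> sets borel_nonneg" "\<sigma> \<subseteq> {..b}" and h: "h \<in> dom T" "E \<sigma> h = h"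
  shows "Re (cinner (the (T h)) h) \<le> b * (norm h)\<^sup>2"
proof -
  interpret finite_measure "spectral_dist E h" by (rule finite_measure_dist)
  have "(\<integral> t. t \<partial>spectral_dist E h) \<le> (\<integral> t. b \<partial>spectral_dist E h)"
    using AE_spectral_dist[OF \<sigma>(1) h(2)] \<sigma>(2)
    by (intro integral_mono_AE integrable_dist[OF h(1)]) auto
  then show ?thesis by (simp add: measure_dist_space cinner_T[OF h(1)] mult.commute)
qed

lemma norm_T_ge:
  assumes \<sigma>: "\<sigma> \<in> sets borel_nonneg" "\<sigma> \<subseteq> {b..}" and h: "h \<in> dom T" "E \<sigma> h = h"
  shows "b * norm h \<le> norm (the (T h))"
proof (cases "h = 0")
  case False
  have "b * (norm h)\<^sup>2 \<le> norm (the (T h)) * norm h"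
    using cinner_T_ge[OF assms] Re_cinner_le[of "the (T h)" h] by linarith
  then show ?thesis using False by (simp add: power2_eq_square)
qed simp

lemma bounded_in_dom:
  assumes \<sigma>: "\<sigma> \<in> sets borel_nonneg" "\<sigma> \<subseteq> {..b}" and h: "E \<sigma> h = h"
  shows "h \<in> dom T"
proof -
  have "AE t in spectral_dist E h. ennreal (t\<^sup>2) \<le> ennreal (b\<^sup>2)"
    using AE_spectral_dist[OF \<sigma>(1) h] \<sigma>
    by (auto intro!: ennreal_leI power_mono simp: sets_borel_nonneg_iff elim!: eventually_mono)
  then have "(\<integral>\<^sup>+ t. ennreal (t\<^sup>2) \<partial>spectral_dist E h) \<le> (\<integral>\<^sup>+ t. ennreal (b\<^sup>2) \<partial>spectral_dist E h)"
    by (rule nn_integral_mono_AE)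
  also have "\<dots> < \<infinity>" by (simp add: emeasure_dist_space ennreal_mult_less_top)
  finally show ?thesis by (simp add: in_dom_iff)
qed

text \<open>The integral formula bounds only the quadratic form. The norm bound follows from
  Cauchy-Schwarz for the positive form <Tx, y> on the range of \<open>E \<sigma>\<close>: with v =
  Th, |v|^4 = <Th, v>^2 <= <Th, h><Tv, v> <= b^2 |h|^2 |v|^2.\<close>

lemma norm_T_le:
  assumes \<sigma>: "\<sigma> \<in> sets borel_nonneg" "\<sigma> \<subseteq> {..b}" and b: "0 \<le> b" and h: "E \<sigma> h = h"
  shows "norm (the (T h)) \<le> b * norm h"
proof (cases "the (T h) = 0")
  case False
  let ?q = "\<lambda>x. Re (cinner (the (T x)) x)"
  define v where "v = the (T h)"
  have dom: "x \<in> dom T" if "E \<sigma> x = x" for x by (rule bounded_in_dom[OF \<sigma> that])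
  have v: "E \<sigma> v = v" using T_E[OF \<sigma>(1) dom[OF h]] h by (simp add: v_def)
  have \<sigma>0: "\<sigma> \<subseteq> {0..}" using \<sigma> by (simp add: sets_borel_nonneg_iff)
  have pos: "0 \<le> ?q x" if "E \<sigma> x = x" for x
    using cinner_T_ge[OF \<sigma>(1) \<sigma>0 dom[OF that] that] by simp
  have le: "?q x \<le> b * (norm x)\<^sup>2" if "E \<sigma> x = x" for x
    by (rule cinner_T_le[OF \<sigma> dom[OF that] that])
  have "0 \<le> ?q h + 2 * t * (norm v)\<^sup>2 + t\<^sup>2 * ?q v" for t
  proof -
    have cross: "cinner (the (T h)) v = complex_of_real ((norm v)\<^sup>2)"
      "cinner (the (T v)) h = complex_of_real ((norm v)\<^sup>2)"
      by (simp_all only: symmetric[OF dom[OF v] dom[OF h]] v_def[symmetric] cinner_self)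
    have tv: "scaleC (complex_of_real t) v \<in> dom T" by (rule dom_scaleC[OF dom[OF v]])
    have "?q (h + scaleC t v) = ?q h + 2 * t * (norm v)\<^sup>2 + t\<^sup>2 * ?q v"
      unfolding T_add[OF dom[OF h] tv] T_scaleC[OF dom[OF v]] cinner_add_left cinner_add_right
        cinner_scaleC_left cinner_scaleC_right cross
      by (simp add: power2_eq_square[of t] algebra_simps)
    then show ?thesis
      using pos[of "h + scaleC t v"] h v by (simp add: E_add[OF \<sigma>(1)] E_scaleC[OF \<sigma>(1)])
  qed
  from quadratic_nonneg_discriminant[OF this pos[OF v]]
  have "((norm v)\<^sup>2)\<^sup>2 \<le> ?q h * ?q v" .
  also have "\<dots> \<le> (b * (norm h)\<^sup>2) * (b * (norm v)\<^sup>2)"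
    using b by (intro mult_mono le h v pos) simp
  finally have "(norm v)\<^sup>2 * (norm v)\<^sup>2 \<le> (b * norm h)\<^sup>2 * (norm v)\<^sup>2"
    by (simp add: power2_eq_square mult_ac)
  then have "(norm v)\<^sup>2 \<le> (b * norm h)\<^sup>2" 
    by (rule mult_right_le_imp_le) (use False in \<open>simp add: v_def\<close>)
  then show ?thesis unfolding v_def by (rule power2_le_imp_le) (simp add: b)
qed (simp add: b)

end
section \<open>Uniqueness of the spectral measure\<close>

context spectral_operator
begin

text \<open>Only the square of \<open>T\<close> enters the right-hand side; this is why \<open>E\<close> is determined by \<open>A\<^sup>*A\<close>.\<close>

lemma range_E_atMost:
  assumes a: "0 \<le> a"
  shows "range (E {0..a}) = {h. \<exists>s. s 0 = h \<and> (\<forall>k. (T \<circ>\<^sub>m T) (s k) = Some (s (Suc k))) \<and>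
    (\<forall>k. norm (s k) \<le> (a\<^sup>2) ^ k * norm h)}" (is "_ = ?R")
proof (intro set_eqI iffI)
  have \<sigma>: "{0..a} \<in> sets borel_nonneg" "{0..a} \<subseteq> {..a}" by (auto simp: sets_borel_nonneg_iff)
  fix h assume "h \<in> range (E {0..a})"
  then have h: "E {0..a} h = h" using E_idem[OF \<sigma>(1)] by auto
  have step: "x \<in> dom T \<and> E {0..a} (the (T x)) = the (T x) \<and> norm (the (T x)) \<le> a * norm x"
    if "E {0..a} x = x" for x
    using bounded_in_dom[OF \<sigma> that] T_E[OF \<sigma>(1) bounded_in_dom[OF \<sigma> that]]
      norm_T_le[OF \<sigma> a that] that by simp
  let ?S = "\<lambda>x. the (T (the (T x)))"
  have S: "(T \<circ>\<^sub>m T) x = Some (?S x)" "E {0..a} (?S x) = ?S x" "norm (?S x) \<le> a\<^sup>2 * norm x"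
    if "E {0..a} x = x" for x
  proof -
    note s1 = step[OF that] and s2 = step[of "the (T x)"]
    show "(T \<circ>\<^sub>m T) x = Some (?S x)" "E {0..a} (?S x) = ?S x" using s1 s2 by auto
    have "norm (?S x) \<le> a * norm (the (T x))" using s1 s2 by simp
    also have "\<dots> \<le> a * (a * norm x)" using s1 a by (intro mult_left_mono) auto
    finally show "norm (?S x) \<le> a\<^sup>2 * norm x" by (simp add: power2_eq_square mult_ac)
  qed
  \<comment> \<open>The witness is the orbit of h under T^2. It stays in the range of E([0,a]),
    where T^2 is defined and bounded by a^2.\<close>
  define s where "s k = (?S ^^ k) h" for k
  have s_Suc: "s (Suc k) = ?S (s k)" for k by (simp add: s_def)
  have fixed: "E {0..a} (s k) = s k" for k
    by (induction k) (use h S(2) in \<open>simp_all add: s_def\<close>)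
  have "norm (s k) \<le> (a\<^sup>2) ^ k * norm h" for k
  proof (induction k)
    case (Suc k)
    have "norm (s (Suc k)) \<le> a\<^sup>2 * norm (s k)" unfolding s_Suc by (rule S(3)[OF fixed])
    also have "\<dots> \<le> a\<^sup>2 * ((a\<^sup>2) ^ k * norm h)" by (intro mult_left_mono Suc) simp
    finally show ?case by (simp add: mult_ac)
  qed (simp add: s_def)
  moreover have "(T \<circ>\<^sub>m T) (s k) = Some (s (Suc k))" for k
    unfolding s_Suc by (rule S(1)[OF fixed])
  moreover have "s 0 = h" by (simp add: s_def)
  ultimately show "h \<in> ?R" by blast
next
  fix h assume "h \<in> ?R"
  then obtain s where s0: "s 0 = h" and s: "\<And>k. (T \<circ>\<^sub>m T) (s k) = Some (s (Suc k))"
    and growth: "\<And>k. norm (s k) \<le> (a\<^sup>2) ^ k * norm h" by blast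
  \<comment> \<open>The component of the orbit in [b,\<infinity>) grows at least like b^(2k), while
    the orbit grows at most like a^(2k); as a < b, that component of h must vanish.\<close>
  have null: "E {b..} h = 0" if "a < b" for b
  proof -
    have b: "0 < b" using a that by simp
    have \<tau>: "{b..} \<in> sets borel_nonneg" "{b..} \<subseteq> {b..}" using b by (auto simp: sets_borel_nonneg_iff)
    have ge: "b * norm (E {b..} x) \<le> norm (E {b..} (the (T x)))" if "x \<in> dom T" for x
      using norm_T_ge[OF \<tau> E_dom[OF \<tau>(1) that] E_idem[OF \<tau>(1)]] by (simp add: T_E[OF \<tau>(1) that])
    have lower: "(b\<^sup>2) ^ k * norm (E {b..} h) \<le> norm (E {b..} (s k))" for k
    proof (induction k)
      case (Suc k)
      have T: "s k \<in> dom T" "the (T (s k)) \<in> dom T" "s (Suc k) = the (T (the (T (s k))))"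
        using s[of k] by (auto simp: map_comp_def split: option.splits)
      have "(b\<^sup>2) ^ Suc k * norm (E {b..} h) \<le> b\<^sup>2 * norm (E {b..} (s k))"
        using mult_left_mono[OF Suc, of "b\<^sup>2"] by (simp add: mult_ac)
      also have "\<dots> = b * (b * norm (E {b..} (s k)))" by (simp add: power2_eq_square)
      also have "\<dots> \<le> b * norm (E {b..} (the (T (s k))))"
        using ge[OF T(1)] b by (intro mult_left_mono) auto
      also have "\<dots> \<le> norm (E {b..} (s (Suc k)))" using ge[OF T(2)] T(3) by simp
      finally show ?case .
    qed (simp add: s0)
    have "norm (E {b..} h) \<le> (a\<^sup>2 / b\<^sup>2) ^ k * norm h" for k
    proof -
      have "(b\<^sup>2) ^ k * norm (E {b..} h) \<le> (a\<^sup>2) ^ k * norm h"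
        using lower[of k] norm_E_le[OF \<tau>(1), of "s k"] growth[of k] by linarith
      then show ?thesis using b by (simp add: field_simps)
    qed
    moreover have "(\<lambda>k. (a\<^sup>2 / b\<^sup>2) ^ k * norm h) \<longlonglongrightarrow> 0"
    proof (intro tendsto_mult_left_zero LIMSEQ_power_zero)
      have "a\<^sup>2 < b\<^sup>2" using a that by (intro power_strict_mono) auto
      then show "norm (a\<^sup>2 / b\<^sup>2) < 1" using b by simp
    qed
    ultimately have "norm (E {b..} h) \<le> 0"
      by (intro LIMSEQ_le_const) auto
    then show ?thesis by simp
  qed
  \<comment> \<open>(a,\<infinity>) is reached from the closed half-lines beyond a by a countable
    union of null sets.\<close>
  have "(\<Union>n. {a + 1 / real (Suc n)..}) \<in> null_sets (spectral_dist E h)"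
    using a by (intro null_sets_UN) (auto simp: null_sets_dist sets_borel_nonneg_iff intro!: null add_nonneg_nonneg)
  also have "(\<Union>n. {a + 1 / real (Suc n)..}) = {0..} - {0..a}"
  proof (intro set_eqI iffI)
    fix t assume "t \<in> {0..} - {0..a}"
    then have "0 < t - a" by auto
    then obtain n where "1 / real (Suc n) < t - a" using nat_approx_posE by metis
    then show "t \<in> (\<Union>n. {a + 1 / real (Suc n)..})" by (auto intro!: exI[of _ n])
  next
    fix t assume "t \<in> (\<Union>n. {a + 1 / real (Suc n)..})"
    then obtain n where "a + 1 / real (Suc n) \<le> t" by auto
    moreover have "0 < 1 / real (Suc n)" by simp
    ultimately have "a < t" by linarith
    then show "t \<in> {0..} - {0..a}" using a by simp
  qed
  finally have "E ({0..} - {0..a}) h = 0" by (simp add: null_sets_dist)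
  moreover have "{0..a} \<in> sets borel_nonneg" by (auto simp: sets_borel_nonneg_iff)
  ultimately have "E {0..a} h = h" using E_split[of "{0..a}" h] by simp
  then show "h \<in> range (E {0..a})" by (metis rangeI)
qed

end

text \<open>By \<open>range_E_atMost\<close> the projections of [0,a] depend only on T^2.
  Complements give the half-lines (a,\<infinity>), which determine the finite measures <E(.)h, h>;
  these give the norms of E(\<sigma>)h, and the norms give the projection.\<close>

lemma spectral_measure_unique:
  assumes "spectral_operator E T" "spectral_operator E' T'"
    and sq: "T \<circ>\<^sub>m T = T' \<circ>\<^sub>m T'" and \<sigma>: "\<sigma> \<in> sets borel_nonneg"
  shows "E \<sigma> = E' \<sigma>"
proof -
  interpret E: spectral_operator E T by fact
  interpret E': spectral_operator E' T' by fact
  have atMost: "E {0..a} = E' {0..a}" if "0 \<le> a" for a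
    by (intro orthogonal_projection_eqI E.proj E'.proj)
      (auto simp: sets_borel_nonneg_iff E.range_E_atMost[OF that] E'.range_E_atMost[OF that] sq)
  have greaterThan: "E ({a<..} \<inter> {0..}) h = E' ({a<..} \<inter> {0..}) h" for a h
  proof (cases "0 \<le> a")
    case True
    have \<tau>: "{0..a} \<in> sets borel_nonneg" by (auto simp: sets_borel_nonneg_iff)
    have "{a<..} \<inter> {0..} = {0..} - {0..a}" using True by auto
    then show ?thesis
      using trans[OF E.E_split[OF \<tau>, of h] E'.E_split[OF \<tau>, of h, symmetric]] atMost[OF True]
      by simp
  next
    case False
    then have "{a<..} \<inter> {0..} = {0..}" by auto
    then show ?thesis by (simp add: E.E_space E'.E_space)
  qed
  show ?thesis
  proof (rule orthogonal_projection_norm_eqI[OF E.proj[OF \<sigma>] E'.proj[OF \<sigma>]])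
    fix h
    \<comment> \<open>Both measures are pushed forward to the whole real line, where agreement on
      all open right half-lines implies equality.\<close>
    let ?D = "distr (spectral_dist E h) borel (\<lambda>t. t)"
    let ?D' = "distr (spectral_dist E' h) borel (\<lambda>t. t)"
    have sets: "\<tau> \<inter> {0..} \<in> sets borel_nonneg" if "\<tau> \<in> sets borel" for \<tau> :: "real set"
      using that by (auto simp: sets_borel_nonneg_iff)
    have D: "emeasure ?D \<tau> = ennreal ((norm (E (\<tau> \<inter> {0..}) h))\<^sup>2)"
      and D': "emeasure ?D' \<tau> = ennreal ((norm (E' (\<tau> \<inter> {0..}) h))\<^sup>2)" if "\<tau> \<in> sets borel" for \<tau>
      using that sets[OF that]
      by (simp_all add: emeasure_distr E.measurable_dist E'.measurable_dist E.emeasure_dist E'.emeasure_dist)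
    have "?D = ?D'"
      by (rule measure_eqI_lessThan) (simp_all add: D D' greaterThan)
    moreover have "\<sigma> \<in> sets borel" "\<sigma> \<inter> {0..} = \<sigma>" using \<sigma> by (auto simp: sets_borel_nonneg_iff)
    ultimately have "(norm (E \<sigma> h))\<^sup>2 = (norm (E' \<sigma> h))\<^sup>2" using D[of \<sigma>] D'[of \<sigma>] by simp
    then show "norm (E \<sigma> h) = norm (E' \<sigma> h)" by simp
  qed
qed

section \<open>An operator and its modulus\<close>

locale modulus_operator = spectral_operator E T
  for E :: "real set \<Rightarrow> 'a::complex_hilbert \<Rightarrow> 'a" and T :: "'a \<rightharpoonup> 'a" +
  fixes A :: "'a \<rightharpoonup> 'a"
  assumes closed_A: "closed_operator A" and dense_A: "densely_defined A"
    and square: "T \<circ>\<^sub>m T = adjoint_operator A \<circ>\<^sub>m A"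
begin

lemma linear_A: "linear_operator A"
  using closed_A unfolding closed_operator_def by blast

lemma tendsto_graph_A:
  assumes x: "x \<longlonglongrightarrow> f" and dom: "\<And>n. x n \<in> dom A" and y: "(\<lambda>n. the (A (x n))) \<longlonglongrightarrow> y"
  shows "A f = Some y"
proof -
  have lim: "(\<lambda>n. (x n, the (A (x n)))) \<longlonglongrightarrow> (f, y)" by (intro tendsto_Pair x y)
  have mem: "(x n, the (A (x n))) \<in> Map.graph A" for n
    using dom[of n] by (auto simp: Map.graph_def)
  have "closed (Map.graph A)" using closed_A unfolding closed_operator_def by blast
  from closed_sequentially[OF this mem lim] have "(f, y) \<in> Map.graph A" .
  then show ?thesis by (simp add: Map.graph_def)
qed

section \<open>Cut-offs to [0,n), and comparison of A with its modulus\<close>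

abbreviation E_below :: "nat \<Rightarrow> 'a \<Rightarrow> 'a" where
  "E_below n \<equiv> E {0..<real n}"

lemma below_sets: "{0..<real n} \<in> sets borel_nonneg" "{0..<real n} \<subseteq> {..real n}"
  by (auto simp: sets_borel_nonneg_iff)

lemma below_below: "E_below m (E_below n x) = E_below (min m n) x"
proof -
  have "{0..<real m} \<inter> {0..<real n} = {0..<real (min m n)}" by (auto simp: min_def)
  then show ?thesis using E_Int[OF below_sets(1) below_sets(1)] by simp
qed

lemma below_dom: "E_below n x \<in> dom T"
  by (rule bounded_in_dom[OF below_sets E_idem[OF below_sets(1)]])

lemma T_below:
  assumes "E_below n x = x"
  shows "E_below n (the (T x)) = the (T x)"
  using T_E[OF below_sets(1) below_dom[of n x], of n] by (simp add: assms)

lemma T_below_dom: "the (T (E_below n x)) \<in> dom T"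
  using below_dom[of n "the (T (E_below n x))"] by (simp add: T_below E_idem[OF below_sets(1)])

text \<open>T maps the range of \<open>E_below n\<close> into itself, so cut-off vectors lie in the
  domain of T^2 = A*A, hence in that of A, and the adjoint identity applies to their images under
  A.\<close>

lemma adjoint_below:
  shows "E_below n x \<in> dom A"
    and "g \<in> dom A \<Longrightarrow>
      cinner (the (A g)) (the (A (E_below n x))) = cinner g (the (T (the (T (E_below n x)))))"
proof -
  have "(T \<circ>\<^sub>m T) (E_below n x) = Some (the (T (the (T (E_below n x)))))"
    using below_dom[of n x] T_below_dom[of n x] by auto
  then have *: "(adjoint_operator A \<circ>\<^sub>m A) (E_below n x) = Some (the (T (the (T (E_below n x)))))"
    unfolding square .
  then show dom: "E_below n x \<in> dom A" by (auto simp: map_comp_def split: option.splits)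
  have "adjoint_operator A (the (A (E_below n x))) = Some (the (T (the (T (E_below n x)))))"
    using * dom by auto
  then show "cinner (the (A g)) (the (A (E_below n x))) = cinner g (the (T (the (T (E_below n x)))))"
    if "g \<in> dom A"
    using that by (simp add: adjoint_operator_eq_Some_iff[OF dense_A])
qed

lemma cinner_A_below:
  assumes "f \<in> dom A"
  shows "cinner (the (A f)) (the (A (E_below n f))) = complex_of_real ((norm (the (T (E_below n f))))\<^sup>2)"
proof -
  let ?y = "the (T (E_below n f))"
  have "cinner (the (A f)) (the (A (E_below n f))) = cinner f (the (T ?y))"
    by (rule adjoint_below(2)[OF assms])
  \<comment> \<open>f is not yet known to lie in \<open>dom T\<close>. Inserting the projection and
    moving it to the other side replaces f by its cut-off, for which T is symmetric.\<close>
  also have "the (T ?y) = E_below n (the (T ?y))"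
    by (simp add: T_below E_idem[OF below_sets(1)])
  also have "cinner f \<dots> = cinner (E_below n f) (the (T ?y))"
    by (rule E_symmetric[OF below_sets(1), symmetric])
  also have "\<dots> = cinner ?y ?y" by (rule symmetric[OF below_dom T_below_dom, symmetric])
  finally show ?thesis by (simp only: cinner_self)
qed

lemma norm_A_below: "norm (the (A (E_below n x))) = norm (the (T (E_below n x)))"
proof -
  have "complex_of_real ((norm (the (A (E_below n x))))\<^sup>2) = complex_of_real ((norm (the (T (E_below n x))))\<^sup>2)"
    using cinner_A_below[OF adjoint_below(1), of n x n]
    unfolding E_idem[OF below_sets(1)] cinner_self .
  then show ?thesis unfolding of_real_eq_iff by simp
qed

text \<open>The difference of two cut-offs is itself a cut-off vector, at level max m n, so
  \<open>norm_A_below\<close> applies to it.\<close>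

lemma norm_A_below_diff:
  "norm (the (A (E_below m x)) - the (A (E_below n x))) = norm (the (T (E_below m x)) - the (T (E_below n x)))"
proof -
  have "E_below (max m n) (E_below m x - E_below n x) = E_below m x - E_below n x"
    by (simp add: E_diff[OF below_sets(1)] below_below)
  then show ?thesis
    using norm_A_below[of "max m n" "E_below m x - E_below n x"]
    by (simp add: linear_operator_diff(2)[OF linear_A adjoint_below(1) adjoint_below(1)]
        T_diff[OF below_dom below_dom])
qed

text \<open>The vectors T E_n f are bounded by |Af|, because |T E_n f|^2 = <Af, A E_n f> and A and T
  have equal norms on cut-offs. Being successive projections of one another they have orthogonal
  increments, hence converge, and T is closed.\<close>

lemma dom_A_subset: "f \<in> dom A \<Longrightarrow> f \<in> dom T"
proof -
  assume f: "f \<in> dom A"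
  let ?x = "\<lambda>n. the (T (E_below n f))"
  have "norm (?x n) \<le> norm (the (A f))" for n
  proof (cases "?x n = 0")
    case False
    have "(norm (?x n))\<^sup>2 \<le> norm (the (A f)) * norm (the (A (E_below n f)))"
      using cmod_cinner_le[of "the (A f)" "the (A (E_below n f))"] unfolding cinner_A_below[OF f]
      by (simp add: norm_power)
    then show ?thesis using False by (simp add: norm_A_below power2_eq_square)
  qed simp
  moreover have "(norm (?x n - ?x m))\<^sup>2 = (norm (?x n))\<^sup>2 - (norm (?x m))\<^sup>2" if "m \<le> n" for m n
  proof -
    have "?x m = E_below m (?x n)"
      using that T_E[OF below_sets(1) below_dom[of n f], of m] by (simp add: below_below min_absorb1)
    then show ?thesis using norm_E_diff[OF below_sets(1), of "?x n" m] by simp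
  qed
  ultimately have "Cauchy ?x" by (intro Cauchy_orthogonal_increments) auto
  then obtain y where "?x \<longlonglongrightarrow> y" using Cauchy_convergent convergentD by blast
  from tendsto_graph[OF E_lessThan_tendsto below_dom this] show "f \<in> dom T" by blast
qed

text \<open>For f in \<open>dom T\<close> the vectors T E_n f = E_n T f converge to Tf. Equality of
  norms on differences of cut-offs makes A E_n f Cauchy, and closedness of A gives both claims in
  the limit.\<close>

lemma
  assumes f: "f \<in> dom T"
  shows dom_T_subset: "f \<in> dom A" and norm_A: "norm (the (A f)) = norm (the (T f))"
proof -
  let ?x = "\<lambda>n. the (T (E_below n f))" and ?y = "\<lambda>n. the (A (E_below n f))"
  have x: "?x \<longlonglongrightarrow> the (T f)"
    unfolding T_E[OF below_sets(1) f] by (rule E_lessThan_tendsto)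
  then have "Cauchy ?x" by (rule LIMSEQ_imp_Cauchy)
  then have "Cauchy ?y" unfolding Cauchy_def dist_norm norm_A_below_diff .
  then obtain y where y: "?y \<longlonglongrightarrow> y" using Cauchy_convergent convergentD by blast
  then have Af: "A f = Some y"
    by (rule tendsto_graph_A[OF E_lessThan_tendsto adjoint_below(1)])
  then show "f \<in> dom A" by blast
  have "(\<lambda>n. norm (?y n)) \<longlonglongrightarrow> norm (the (T f))"
    unfolding norm_A_below by (intro tendsto_norm x)
  moreover have "(\<lambda>n. norm (?y n)) \<longlonglongrightarrow> norm y" by (intro tendsto_norm y)
  ultimately show "norm (the (A f)) = norm (the (T f))" using Af LIMSEQ_unique by fastforce
qed

lemma dom_A: "dom A = dom T"
  using dom_A_subset dom_T_subset by blast

section \<open>Commutation of A with the spectral projections\<close>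

definition commutes :: bool where
  "commutes \<longleftrightarrow> (\<forall>\<sigma>\<in>sets borel_nonneg. \<forall>f\<in>dom A. the (A (E \<sigma> f)) = E \<sigma> (the (A f)))"

text \<open>The domain part of the inclusion is automatic: \<open>dom A\<close> equals
  \<open>dom T\<close>, which every \<open>E \<sigma>\<close> leaves invariant.\<close>

lemma commutes_iff:
  "commutes \<longleftrightarrow> (\<forall>\<sigma>\<in>sets borel_nonneg. (Some \<circ> E \<sigma>) \<circ>\<^sub>m A \<subseteq>\<^sub>m A \<circ>\<^sub>m (Some \<circ> E \<sigma>))"
proof -
  have "((Some \<circ> E \<sigma>) \<circ>\<^sub>m A \<subseteq>\<^sub>m A \<circ>\<^sub>m (Some \<circ> E \<sigma>)) \<longleftrightarrow> (\<forall>f\<in>dom A. the (A (E \<sigma> f)) = E \<sigma> (the (A f)))"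
    if "\<sigma> \<in> sets borel_nonneg" for \<sigma>
  proof -
    have dom: "dom ((Some \<circ> E \<sigma>) \<circ>\<^sub>m A) = dom A"
      by (auto simp: map_comp_def split: option.splits)
    have "((Some \<circ> E \<sigma>) \<circ>\<^sub>m A) f = (A \<circ>\<^sub>m (Some \<circ> E \<sigma>)) f \<longleftrightarrow> the (A (E \<sigma> f)) = E \<sigma> (the (A f))"
      if "f \<in> dom A" for f
    proof -
      have "E \<sigma> f \<in> dom A" using that E_dom[OF \<open>\<sigma> \<in> sets borel_nonneg\<close>] by (simp add: dom_A)
      then show ?thesis using that by (auto simp: map_comp_def)
    qed
    then show ?thesis unfolding map_le_def dom by auto
  qed
  then show ?thesis unfolding commutes_def by blast
qed

lemma commutes_imp_norm_eq:
  assumes commutes and \<sigma>: "\<sigma> \<in> sets borel_nonneg" and f: "f \<in> dom A"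
  shows "norm (E \<sigma> (the (A f))) = norm (E \<sigma> (the (T f)))"
proof -
  have fT: "f \<in> dom T" using f by (simp add: dom_A)
  have "norm (E \<sigma> (the (A f))) = norm (the (A (E \<sigma> f)))"
    using assms unfolding commutes_def by simp
  also have "\<dots> = norm (the (T (E \<sigma> f)))" by (rule norm_A[OF E_dom[OF \<sigma> fT]])
  finally show ?thesis by (simp add: T_E[OF \<sigma> fT])
qed

lemma absolutely_continuous_imp_commutes:
  assumes ac: "\<And>f. f \<in> dom A \<Longrightarrow>
    absolutely_continuous (spectral_dist E (the (T f))) (spectral_dist E (the (A f)))"
  shows commutes
  unfolding commutes_def
proof (intro ballI)
  fix \<sigma> f assume \<sigma>: "\<sigma> \<in> sets borel_nonneg" and f: "f \<in> dom A"
  have \<sigma>': "{0..} - \<sigma> \<in> sets borel_nonneg" by (rule Diff_sets_borel_nonneg[OF \<sigma>])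
  have fT: "f \<in> dom T" using f by (simp add: dom_A)
  have dom: "E \<sigma> f \<in> dom A" "E ({0..} - \<sigma>) f \<in> dom A"
    using E_dom[OF _ fT] \<sigma> \<sigma>' by (simp_all add: dom_A)
  \<comment> \<open>A set \<tau> is null for <E(.)h, h> exactly when E(\<tau>)h = 0, so absolute
    continuity carries this vanishing from Tg to Ag.\<close>
  have transfer: "E \<tau> (the (A g)) = 0" if "g \<in> dom A" "\<tau> \<in> sets borel_nonneg" "E \<tau> (the (T g)) = 0" for g \<tau>
  proof -
    have "\<tau> \<in> null_sets (spectral_dist E (the (T g)))" using that by (simp add: null_sets_dist)
    then have "\<tau> \<in> null_sets (spectral_dist E (the (A g)))"
      using ac[OF that(1)] unfolding absolutely_continuous_def by blast
    then show ?thesis by (simp add: null_sets_dist)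
  qed
  have 1: "E ({0..} - \<sigma>) (the (A (E \<sigma> f))) = 0"
    by (intro transfer dom \<sigma>') (rule T_range[OF \<sigma> fT])
  have "E \<sigma> (the (T (E ({0..} - \<sigma>) f))) = 0"
    unfolding T_E[OF \<sigma>' fT] by (rule E_disjoint[OF \<sigma> \<sigma>']) blast
  then have 2: "E \<sigma> (the (A (E ({0..} - \<sigma>) f))) = 0"
    by (intro transfer dom \<sigma>)
  \<comment> \<open>By 2 the second summand is annihilated by \<open>E \<sigma>\<close>; by 1 the
    first is fixed by it.\<close>
  have "the (A f) = the (A (E \<sigma> f)) + the (A (E ({0..} - \<sigma>) f))"
    using linear_operator_add[OF linear_A dom] by (simp add: E_split[OF \<sigma>])
  then have "E \<sigma> (the (A f)) = E \<sigma> (the (A (E \<sigma> f)))" by (simp add: E_add[OF \<sigma>] 2)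
  also have "\<dots> = the (A (E \<sigma> f))" using E_split[OF \<sigma>, of "the (A (E \<sigma> f))"] 1 by simp
  finally show "the (A (E \<sigma> f)) = E \<sigma> (the (A f))" by simp
qed

text \<open>Quasinormality may be witnessed by another modulus T' with spectral measure E'. Both
  squares equal A*A, so E' agrees with E on the Borel sets.\<close>

lemma quasinormal_iff_commutes:
  assumes "is_modulus A T"
  shows "quasinormal A \<longleftrightarrow> commutes"
proof
  assume "quasinormal A"
  then obtain T' E' where T': "is_modulus A T'" "is_spectral_measure_of E' T'"
    and comm: "\<forall>\<sigma>\<in>sets borel_nonneg. (Some \<circ> E' \<sigma>) \<circ>\<^sub>m A \<subseteq>\<^sub>m A \<circ>\<^sub>m (Some \<circ> E' \<sigma>)"
    unfolding quasinormal_def by blast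
  have E': "spectral_operator E' T'"
    using T' unfolding is_modulus_def is_spectral_measure_of_def
    by unfold_locales (auto simp: is_spectral_measure_of_def)
  have "T \<circ>\<^sub>m T = T' \<circ>\<^sub>m T'" using T'(1) square unfolding is_modulus_def by simp
  then have "E \<sigma> = E' \<sigma>" if "\<sigma> \<in> sets borel_nonneg" for \<sigma>
    using spectral_measure_unique[OF spectral_operator_axioms E'] that by blast
  then show commutes unfolding commutes_iff using comm by simp
next
  assume commutes
  then show "quasinormal A"
    unfolding quasinormal_def commutes_iff
    using closed_A dense_A assms spectral_measure_of by blast
qed

end

section \<open>Equivalence of the three conditions\<close>

theorem theorem3p1:
  fixes A absA :: "'a::complex_hilbert \<rightharpoonup> 'a"
    and E :: "real set \<Rightarrow> 'a \<Rightarrow> 'a"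
  assumes "closed_operator A"
    and "densely_defined A"
    and "is_modulus A absA"
    and "is_spectral_measure_of E absA"
  shows "(quasinormal A \<longleftrightarrow>
            (\<forall>\<sigma>\<in>sets borel_nonneg. \<forall>f\<in>dom A.
               cinner (E \<sigma> (the (A f))) (the (A f)) =
               cinner (E \<sigma> (the (absA f))) (the (absA f)))) \<and>
         (quasinormal A \<longleftrightarrow>
            (\<forall>f\<in>dom A.
               absolutely_continuous (spectral_dist E (the (absA f))) (spectral_dist E (the (A f)))))"
    (is "(_ \<longleftrightarrow> ?ii) \<and> (_ \<longleftrightarrow> ?iii)")
proof -
  interpret modulus_operator E absA A
    using assms unfolding is_modulus_def is_spectral_measure_of_def
    by unfold_locales (auto simp: is_spectral_measure_of_def)
  \<comment> \<open>The equivalences are closed as a cycle: commutation gives (ii), (ii) gives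
    (iii), and (iii) gives commutation.\<close>
  have "?ii" if commutes
    using commutes_imp_norm_eq[OF that] by (simp add: cinner_E)
  moreover have "?iii" if ?ii
    unfolding absolutely_continuous_def
  proof (intro ballI subsetI)
    fix f \<sigma> assume f: "f \<in> dom A" and "\<sigma> \<in> null_sets (spectral_dist E (the (absA f)))"
    then have \<sigma>: "\<sigma> \<in> sets borel_nonneg" and "E \<sigma> (the (absA f)) = 0"
      by (simp_all add: null_sets_dist)
    \<comment> \<open>Both sides of (ii) are squared norms of projected vectors, so they vanish
      together.\<close>
    then have "E \<sigma> (the (A f)) = 0" using that f \<sigma> by (force simp: cinner_E)
    then show "\<sigma> \<in> null_sets (spectral_dist E (the (A f)))" using \<sigma> by (simp add: null_sets_dist)
  qed
  moreover have commutes if ?iii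
    using that by (intro absolutely_continuous_imp_commutes) blast
  ultimately show ?thesis unfolding quasinormal_iff_commutes[OF assms(3)] by blast
qed

end
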